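(* Let $X\neq\emptyset$ be a left near-truss, $Y$ be a subnear-truss of $X$, and $\omega$ a congruence on the left near-truss $X$. The following conditions are equivalent: (a) $Y$ is a set of representatives of the equivalence classes of $X$ modulo $\omega$ (i.e., $Y\cap[x]_\omega$ is a singleton for every $x\in X$). (b) There exists an idempotent left near-truss endomorphism of $X$ whose image is $Y$ and whose kernel is $\omega$. (c) For every $e\in Y$, there exists an idempotent $J$-ring endomorphism of the $J$-ring $(X,b_e,\cdot)$ whose image is the sub-$J$-ring $Y$ of $(X,b_e,\cdot)$ and whose kernel is the ideal $[e]_\omega$ of $(X,b_e,\cdot)$. (d) There exist an element $e\in Y$ and an idempotent $J$-ring endomorphism of the $J$-ring $(X,b_e,\cdot)$ whose image is the sub-$J$-ring $Y$ of $(X,b_e,\cdot)$ and whose kernel is the ideal $[e]_\omega$ of $(X,b_e,\cdot)$. (e) For every $e\in Y$, the group $(X,b_e)$ is the semidirect product of its subgroup $Y$ and its normal subgroup $[e]_\omega$. (f) There exists an element $e\in Y$ such that the group $(X,b_e)$ is the semidirect product of its subgroup $Y$ and its normal subgroup $[e]_\omega$. (g) For every $a\in X$ and every $c\in Y$ there exist a unique element $b\in X$ and a unique element $d\in Y$ such that $a=p(b,c,d)$ and $b\,\omega\,c$. (h) For every $a\in X$ and every $c\in Y$ there exist a unique element $b\in X$ and a unique element $d\in Y$ such that $a=p(d,c,b)$ and $b\,\omega\,c$. (i) The mapping $g\colon Y\to X/\omega$, defined by $g(y)=[y]_\omega$ for every $y\in Y$, is a left near-truss isomorphism. (l) There exists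 a left near-truss endomorphism of $X$ whose kernel is $\omega$ and whose restriction to $Y$ is the inclusion of $Y$ in $X$.
   Context: A heap is a set $X$ with a ternary operation, written $[x,y,z]$ or $p(x,y,z)$, such that $[[x,y,z],w,u]=[x,y,[z,w,u]]$, $[x,x,y]=y$ and $[x,y,y]=x$ for all $x,y,z,w,u\in X$. A left near-truss $(X,[-,-,-],\cdot)$ is a heap $(X,[-,-,-])$ with an associative binary operation $\cdot$ such that $x\cdot[y,z,w]=[x\cdot y,x\cdot z,x\cdot w]$ for all $x,y,z,w\in X$. Morphisms of left near-trusses preserve both operations; a subnear-truss is a subset closed under both operations; a congruence is an equivalence relation compatible with both operations. $[x]_\omega$ denotes the class of $x$ modulo $\omega$. The kernel of a left near-truss morphism $f$ is the congruence $\{(x,x')\mid f(x)=f(x')\}$. For $e\in X$, $b_e(x,z)=[x,e,z]$; $(X,b_e)$ is a group with identity $e$. A $J$-ring $(X,+,-,0,\cdot)$ is a (not necessarily abelian) group $(X,+,-,0)$ with an associative multiplication $\cdot$ such that $z(x+y)=zx-(z\cdot 0)+zy$ for all $x,y,z$; for every $e\in X$, $(X,b_e,\cdot)$ is a $J$-ring with zero element $e$. $J$-ring morphisms preserve all the operations (in particular $0$), and the kernel of a $J$-ring morphism is the inverse image of $0$. An ideal of a $J$-ring is a normal subgroup $N$ of $(X,+)$ such that $xn-x\cdot 0\in N$ and $(x+n)y-xy\in N$ for all $x,y\in X$, $n\in N$. For $e\in Y$, $Y$ is a sub-$J$-ring and $[e]_\omega$ is an ideal of $(X,b_e,\cdot)$.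 A group $G$ is the (inner) semidirect product of a subgroup $H$ and a normal subgroup $N$ if $G=NH$ and $N\cap H$ is trivial.
   Formalization: Y is assumed nonempty (for empty Y, (c), (e), (g), (h) hold vacuously but (a) fails), and in (l) the endomorphism is also required to map X into Y (otherwise the identity satisfies (l) whenever ω is equality, for every Y). *)

theory Defs
  imports "HOL-Algebra.Coset"
begin

section \<open>Heaps and left near-trusses\<close>

record 'a heap = "'a partial_object" +
  tern :: "'a \<Rightarrow> 'a \<Rightarrow> 'a \<Rightarrow> 'a"

record 'a near_truss = "'a heap" +
  tmult :: "'a \<Rightarrow> 'a \<Rightarrow> 'a"  (infixl \<open>\<cdot>\<index>\<close> 70)

locale heap =
  fixes X (structure)
  assumes tern_closed:
      "\<lbrakk>x \<in> carrier X; y \<in> carrier X; z \<in> carrier X\<rbrakk> \<Longrightarrow> tern X x y z \<in> carrier X"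
    and tern_assoc:
      "\<lbrakk>x \<in> carrier X; y \<in> carrier X; z \<in> carrier X; w \<in> carrier X; u \<in> carrier X\<rbrakk>
        \<Longrightarrow> tern X (tern X x y z) w u = tern X x y (tern X z w u)"
    and tern_left_cancel: "\<lbrakk>x \<in> carrier X; y \<in> carrier X\<rbrakk> \<Longrightarrow> tern X x x y = y"
    and tern_right_cancel: "\<lbrakk>x \<in> carrier X; y \<in> carrier X\<rbrakk> \<Longrightarrow> tern X x y y = x"

locale left_near_truss = heap X for X (structure) +
  assumes tmult_closed:
      "\<lbrakk>x \<in> carrier X; y \<in> carrier X\<rbrakk> \<Longrightarrow> x \<cdot> y \<in> carrier X"
    and tmult_assoc:
      "\<lbrakk>x \<in> carrier X; y \<in> carrier X; z \<in> carrier X\<rbrakk> \<Longrightarrow> (x \<cdot> y) \<cdot> z = x \<cdot> (y \<cdot> z)"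
    and tmult_distrib:
      "\<lbrakk>x \<in> carrier X; y \<in> carrier X; z \<in> carrier X; w \<in> carrier X\<rbrakk>
        \<Longrightarrow> x \<cdot> tern X y z w = tern X (x \<cdot> y) (x \<cdot> z) (x \<cdot> w)"

definition near_truss_hom ::
  "('a, 'm) near_truss_scheme \<Rightarrow> ('b, 'n) near_truss_scheme \<Rightarrow> ('a \<Rightarrow> 'b) set" where
  "near_truss_hom X Z = {f. f \<in> carrier X \<rightarrow> carrier Z \<and>
     (\<forall>x \<in> carrier X. \<forall>y \<in> carrier X. \<forall>z \<in> carrier X.
        f (tern X x y z) = tern Z (f x) (f y) (f z)) \<and>
     (\<forall>x \<in> carrier X. \<forall>y \<in> carrier X. f (x \<cdot>\<^bsub>X\<^esub> y) = f x \<cdot>\<^bsub>Z\<^esub> f y)}"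

definition near_truss_iso ::
  "('a, 'm) near_truss_scheme \<Rightarrow> ('b, 'n) near_truss_scheme \<Rightarrow> ('a \<Rightarrow> 'b) set" where
  "near_truss_iso X Z = {f \<in> near_truss_hom X Z. bij_betw f (carrier X) (carrier Z)}"

definition near_truss_kernel :: "('a, 'm) near_truss_scheme \<Rightarrow> ('a \<Rightarrow> 'b) \<Rightarrow> 'a rel" where
  "near_truss_kernel X f = {(x, x'). x \<in> carrier X \<and> x' \<in> carrier X \<and> f x = f x'}"

text \<open>The empty set is not excluded.\<close>

definition subnear_truss :: "'a set \<Rightarrow> ('a, 'm) near_truss_scheme \<Rightarrow> bool" where
  "subnear_truss Y X \<longleftrightarrow> Y \<subseteq> carrier X \<and>
     (\<forall>x \<in> Y. \<forall>y \<in> Y. \<forall>z \<in> Y. tern X x y z \<in> Y) \<and>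
     (\<forall>x \<in> Y. \<forall>y \<in> Y. x \<cdot>\<^bsub>X\<^esub> y \<in> Y)"

definition near_truss_congruence :: "'a rel \<Rightarrow> ('a, 'm) near_truss_scheme \<Rightarrow> bool" where
  "near_truss_congruence \<omega> X \<longleftrightarrow> equiv (carrier X) \<omega> \<and>
     (\<forall>x x' y y' z z'. (x, x') \<in> \<omega> \<longrightarrow> (y, y') \<in> \<omega> \<longrightarrow> (z, z') \<in> \<omega> \<longrightarrow>
        (tern X x y z, tern X x' y' z') \<in> \<omega>) \<and>
     (\<forall>x x' y y'. (x, x') \<in> \<omega> \<longrightarrow> (y, y') \<in> \<omega> \<longrightarrow> (x \<cdot>\<^bsub>X\<^esub> y, x' \<cdot>\<^bsub>X\<^esub> y') \<in> \<omega>)"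

text \<open>The class of \<open>x\<close> modulo \<open>\<omega>\<close> is \<open>\<omega> `` {x}\<close>. For a congruence the unions below run over
  constant families of classes, so an operation on classes is the class of the operation applied
  to arbitrary representatives.\<close>

definition near_truss_quotient ::
  "('a, 'm) near_truss_scheme \<Rightarrow> 'a rel \<Rightarrow> 'a set near_truss" where
  "near_truss_quotient X \<omega> =
     \<lparr>carrier = carrier X // \<omega>,
      tern = (\<lambda>A B C. \<Union>a \<in> A. \<Union>b \<in> B. \<Union>c \<in> C. \<omega> `` {tern X a b c}),
      tmult = (\<lambda>A B. \<Union>a \<in> A. \<Union>b \<in> B. \<omega> `` {a \<cdot>\<^bsub>X\<^esub> b})\<rparr>"


section \<open>J-rings\<close>

text \<open>The additive group \<open>(X, +, -, 0)\<close> of a J-ring is not necessarily abelian. It is a group of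
  HOL-Algebra and hence appears in multiplicative notation: \<open>x \<otimes> y\<close>, \<open>inv x\<close> and \<open>\<one>\<close> stand for
  \<open>x + y\<close>, \<open>-x\<close> and \<open>0\<close>, while \<open>x \<odot> y\<close> is the multiplication of the J-ring.\<close>

record 'a j_ring = "'a monoid" +
  jmult :: "'a \<Rightarrow> 'a \<Rightarrow> 'a"  (infixl \<open>\<odot>\<index>\<close> 75)

locale j_ring = group R for R (structure) +
  assumes jmult_closed:
      "\<lbrakk>x \<in> carrier R; y \<in> carrier R\<rbrakk> \<Longrightarrow> x \<odot> y \<in> carrier R"
    and jmult_assoc:
      "\<lbrakk>x \<in> carrier R; y \<in> carrier R; z \<in> carrier R\<rbrakk> \<Longrightarrow> (x \<odot> y) \<odot> z = x \<odot> (y \<odot> z)"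
    and jmult_distrib:
      "\<lbrakk>x \<in> carrier R; y \<in> carrier R; z \<in> carrier R\<rbrakk>
        \<Longrightarrow> z \<odot> (x \<otimes> y) = (z \<odot> x) \<otimes> inv (z \<odot> \<one>) \<otimes> (z \<odot> y)"

text \<open>The kernel of a J-ring morphism is the library's group-theoretic \<^const>\<open>kernel\<close>.\<close>

definition j_ring_hom ::
  "('a, 'm) j_ring_scheme \<Rightarrow> ('b, 'n) j_ring_scheme \<Rightarrow> ('a \<Rightarrow> 'b) set" where
  "j_ring_hom R S = {f \<in> hom R S.
     f \<one>\<^bsub>R\<^esub> = \<one>\<^bsub>S\<^esub> \<and>
     (\<forall>x \<in> carrier R. f (inv\<^bsub>R\<^esub> x) = inv\<^bsub>S\<^esub> (f x)) \<and>
     (\<forall>x \<in> carrier R. \<forall>y \<in> carrier R. f (x \<odot>\<^bsub>R\<^esub> y) = f x \<odot>\<^bsub>S\<^esub> f y)}"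

definition sub_j_ring :: "'a set \<Rightarrow> ('a, 'm) j_ring_scheme \<Rightarrow> bool" where
  "sub_j_ring H R \<longleftrightarrow> subgroup H R \<and> (\<forall>x \<in> H. \<forall>y \<in> H. x \<odot>\<^bsub>R\<^esub> y \<in> H)"

definition j_ideal :: "'a set \<Rightarrow> ('a, 'm) j_ring_scheme \<Rightarrow> bool" where
  "j_ideal N R \<longleftrightarrow> N \<lhd> R \<and>
     (\<forall>x \<in> carrier R. \<forall>n \<in> N. (x \<odot>\<^bsub>R\<^esub> n) \<otimes>\<^bsub>R\<^esub> inv\<^bsub>R\<^esub> (x \<odot>\<^bsub>R\<^esub> \<one>\<^bsub>R\<^esub>) \<in> N) \<and>
     (\<forall>x \<in> carrier R. \<forall>y \<in> carrier R. \<forall>n \<in> N.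
        ((x \<otimes>\<^bsub>R\<^esub> n) \<odot>\<^bsub>R\<^esub> y) \<otimes>\<^bsub>R\<^esub> inv\<^bsub>R\<^esub> (x \<odot>\<^bsub>R\<^esub> y) \<in> N)"

definition idempotent_on :: "'a set \<Rightarrow> ('a \<Rightarrow> 'a) \<Rightarrow> bool" where
  "idempotent_on A f \<longleftrightarrow> (\<forall>x \<in> A. f (f x) = f x)"

text \<open>The group \<open>(X, b\<^sub>e)\<close> and the J-ring \<open>(X, b\<^sub>e, \<cdot>)\<close>.\<close>

definition heap_group :: "('a, 'm) heap_scheme \<Rightarrow> 'a \<Rightarrow> 'a monoid" where
  "heap_group X e = \<lparr>carrier = carrier X, mult = (\<lambda>x z. tern X x e z), one = e\<rparr>"

definition truss_j_ring :: "('a, 'm) near_truss_scheme \<Rightarrow> 'a \<Rightarrow> 'a j_ring" where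
  "truss_j_ring X e =
     \<lparr>carrier = carrier X, mult = (\<lambda>x z. tern X x e z), one = e, jmult = tmult X\<rparr>"


section \<open>Semidirect products and lists of equivalent conditions\<close>

definition inner_semidirect :: "('a, 'm) monoid_scheme \<Rightarrow> 'a set \<Rightarrow> 'a set \<Rightarrow> bool" where
  "inner_semidirect G H N \<longleftrightarrow>
     group G \<and> subgroup H G \<and> N \<lhd> G \<and> carrier G = N <#>\<^bsub>G\<^esub> H \<and> N \<inter> H = {\<one>\<^bsub>G\<^esub>}"

definition all_equivalent :: "bool list \<Rightarrow> bool" where
  "all_equivalent Ps \<longleftrightarrow> (\<forall>P \<in> set Ps. \<forall>Q \<in> set Ps. P \<longleftrightarrow> Q)"

end

(* Every condition is compared with (a), restated as: each x in X is congruent to exactly one y in Y.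
   Under (a), sending x to its representative is an endomorphism because Y is closed under the
   operations. For any e in X, x and y are congruent iff the difference [x, y, e] = x - y in
   (X, b_e) lies in the class of e. This recovers the whole congruence from one of its classes and
   leads from the conditions on a single J-ring or group (X, b_e) back to (a). *)

theory Submission
  imports Defs
begin

section \<open>The groups \<open>(X, b_e)\<close> of a heap\<close>

context heap
begin

text \<open>In any group \<open>(X, b_e)\<close> the bracket \<open>[x, y, z]\<close> is x - y + z,
  so the inner -y + y of neighbouring brackets cancels wherever \<open>e\<close> lies.\<close>

lemma tern_chain_right:
  "\<lbrakk>x \<in> carrier X; y \<in> carrier X; z \<in> carrier X; w \<in> carrier X\<rbrakk>
    \<Longrightarrow> tern X x y (tern X y z w) = tern X x z w"
  using tern_assoc tern_right_cancel by metis

lemma tern_chain_left: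
  "\<lbrakk>x \<in> carrier X; y \<in> carrier X; z \<in> carrier X; w \<in> carrier X\<rbrakk>
    \<Longrightarrow> tern X (tern X x y z) z w = tern X x y w"
  using tern_assoc tern_left_cancel by simp

lemma group_heap_group:
  assumes "e \<in> carrier X"
  shows "group (heap_group X e)"
proof (rule groupI)
  fix x assume "x \<in> carrier (heap_group X e)"
  then show "\<exists>y \<in> carrier (heap_group X e). y \<otimes>\<^bsub>heap_group X e\<^esub> x = \<one>\<^bsub>heap_group X e\<^esub>"
    using assms
    by (intro bexI[of _ "tern X e x e"])
      (auto simp: heap_group_def tern_closed tern_assoc tern_left_cancel tern_right_cancel)
qed (use assms in \<open>auto simp: heap_group_def tern_closed tern_assoc tern_left_cancel\<close>)

lemma inv_heap_group:
  assumes "e \<in> carrier X" "x \<in> carrier X"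
  shows "inv\<^bsub>heap_group X e\<^esub> x = tern X e x e"
proof (rule group.inv_equality[OF group_heap_group])
  show "tern X e x e \<otimes>\<^bsub>heap_group X e\<^esub> x = \<one>\<^bsub>heap_group X e\<^esub>"
    using assms
    by (simp add: heap_group_def tern_assoc tern_left_cancel tern_right_cancel)
qed (use assms in \<open>auto simp: heap_group_def tern_closed\<close>)

end

section \<open>The J-rings of a left near-truss\<close>

lemma truss_j_ring_simps [simp]:
  "carrier (truss_j_ring X e) = carrier X"
  "mult (truss_j_ring X e) = (\<lambda>x z. tern X x e z)"
  "one (truss_j_ring X e) = e"
  "jmult (truss_j_ring X e) = tmult X"
  by (simp_all add: truss_j_ring_def)

lemma heap_group_simps [simp]:
  "carrier (heap_group X e) = carrier X"
  "mult (heap_group X e) = (\<lambda>x z. tern X x e z)"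
  "one (heap_group X e) = e"
  by (simp_all add: heap_group_def)

text \<open>The two structures are records of different types, but \<open>m_inv\<close> sees only
  the carrier, product and unit, which they share.\<close>

lemma inv_truss_j_ring_eq_inv_heap_group:
  "inv\<^bsub>truss_j_ring X e\<^esub> x = inv\<^bsub>heap_group X e\<^esub> x"
  by (simp add: m_inv_def)

context left_near_truss
begin

lemma inv_truss_j_ring:
  "\<lbrakk>e \<in> carrier X; x \<in> carrier X\<rbrakk> \<Longrightarrow> inv\<^bsub>truss_j_ring X e\<^esub> x = tern X e x e"
  by (simp add: inv_truss_j_ring_eq_inv_heap_group inv_heap_group)

lemma group_truss_j_ring: "e \<in> carrier X \<Longrightarrow> group (truss_j_ring X e)"
  using group_heap_group[of e]
  by (auto simp: group_def monoid_def group_axioms_def Units_def)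

text \<open>The J-ring law is distributivity over the bracket \<open>[x, e, y]\<close>, because
  \<open>[zx, ze, zy]\<close> is zx - ze + zy in \<open>(X, b_e)\<close>.\<close>

lemma j_ring_truss_j_ring:
  assumes "e \<in> carrier X"
  shows "j_ring (truss_j_ring X e)"
proof (intro j_ring.intro j_ring_axioms.intro)
  show "group (truss_j_ring X e)"
    by (rule group_truss_j_ring[OF assms])
next
  fix x y z
  assume "x \<in> carrier (truss_j_ring X e)" "y \<in> carrier (truss_j_ring X e)"
    "z \<in> carrier (truss_j_ring X e)"
  then show "z \<odot>\<^bsub>truss_j_ring X e\<^esub> (x \<otimes>\<^bsub>truss_j_ring X e\<^esub> y) =
      z \<odot>\<^bsub>truss_j_ring X e\<^esub> x \<otimes>\<^bsub>truss_j_ring X e\<^esub>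
        inv\<^bsub>truss_j_ring X e\<^esub> (z \<odot>\<^bsub>truss_j_ring X e\<^esub> \<one>\<^bsub>truss_j_ring X e\<^esub>) \<otimes>\<^bsub>truss_j_ring X e\<^esub>
        (z \<odot>\<^bsub>truss_j_ring X e\<^esub> y)"
    using assms
    by (simp add: inv_truss_j_ring tmult_closed tmult_distrib tern_closed tern_assoc
        tern_left_cancel tern_chain_right)
qed (auto simp: tmult_closed tmult_assoc)

text \<open>Sum and inverse are the brackets \<open>[x, e, z]\<close> and \<open>[e, x, e]\<close>;
  a morphism that fixes \<open>e\<close> preserves both.\<close>

lemma near_truss_hom_imp_j_ring_hom:
  assumes f: "f \<in> near_truss_hom X X" and e: "e \<in> carrier X" "f e = e"
  shows "f \<in> j_ring_hom (truss_j_ring X e) (truss_j_ring X e)"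
  using assms
  by (auto simp: near_truss_hom_def j_ring_hom_def hom_def inv_truss_j_ring Pi_iff)

end

section \<open>Congruences and sets of representatives\<close>

locale subnear_truss_congruence = left_near_truss X for X (structure) +
  fixes Y :: "'a set" and \<omega> :: "'a rel"
  assumes subnear_truss: "subnear_truss Y X"
    and nonempty: "Y \<noteq> {}"
    and congruence: "near_truss_congruence \<omega> X"
begin

definition representatives :: bool where
  "representatives \<longleftrightarrow> (\<forall>x \<in> carrier X. \<exists>!y. y \<in> Y \<and> (x, y) \<in> \<omega>)"

lemma representatives_iff_is_singleton:
  "representatives \<longleftrightarrow> (\<forall>x \<in> carrier X. is_singleton (Y \<inter> \<omega> `` {x}))"
  unfolding representatives_def is_singleton_iff_ex1 by auto

lemma Y_carrier: "y \<in> Y \<Longrightarrow> y \<in> carrier X"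
  and Y_tern: "\<lbrakk>x \<in> Y; y \<in> Y; z \<in> Y\<rbrakk> \<Longrightarrow> tern X x y z \<in> Y"
  and Y_tmult: "\<lbrakk>x \<in> Y; y \<in> Y\<rbrakk> \<Longrightarrow> x \<cdot> y \<in> Y"
  using subnear_truss by (auto simp: subnear_truss_def)

lemma equiv: "equiv (carrier X) \<omega>"
  and tern_cong:
    "\<lbrakk>(x, x') \<in> \<omega>; (y, y') \<in> \<omega>; (z, z') \<in> \<omega>\<rbrakk> \<Longrightarrow> (tern X x y z, tern X x' y' z') \<in> \<omega>"
  and tmult_cong: "\<lbrakk>(x, x') \<in> \<omega>; (y, y') \<in> \<omega>\<rbrakk> \<Longrightarrow> (x \<cdot> y, x' \<cdot> y') \<in> \<omega>"
  using congruence by (auto simp: near_truss_congruence_def)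

lemma \<omega>_carrier: "(x, y) \<in> \<omega> \<Longrightarrow> x \<in> carrier X" "(x, y) \<in> \<omega> \<Longrightarrow> y \<in> carrier X"
  using equiv by (auto simp: equiv_def)

lemma \<omega>_refl: "x \<in> carrier X \<Longrightarrow> (x, x) \<in> \<omega>"
  and \<omega>_sym: "(x, y) \<in> \<omega> \<Longrightarrow> (y, x) \<in> \<omega>"
  and \<omega>_trans: "\<lbrakk>(x, y) \<in> \<omega>; (y, z) \<in> \<omega>\<rbrakk> \<Longrightarrow> (x, z) \<in> \<omega>"
  using equiv by (auto simp: equiv_def intro: refl_onD elim: symE transE)

text \<open>The map \<open>[-, y, e]\<close> respects \<omega> and sends \<open>y\<close> to
  \<open>e\<close>; its inverse \<open>[-, e, y]\<close> respects \<omega> as well.\<close>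

lemma \<omega>_iff_tern:
  assumes "x \<in> carrier X" "y \<in> carrier X" "e \<in> carrier X"
  shows "(x, y) \<in> \<omega> \<longleftrightarrow> (e, tern X x y e) \<in> \<omega>"
proof
  assume "(x, y) \<in> \<omega>"
  then show "(e, tern X x y e) \<in> \<omega>"
    using tern_cong[OF \<omega>_sym \<omega>_refl \<omega>_refl, of x y y e] assms
    by (simp add: tern_left_cancel)
next
  assume "(e, tern X x y e) \<in> \<omega>"
  then have "(tern X (tern X x y e) e y, tern X e e y) \<in> \<omega>"
    using assms by (intro tern_cong \<omega>_refl) (rule \<omega>_sym)
  then show "(x, y) \<in> \<omega>"
    using assms by (simp add: tern_assoc tern_left_cancel tern_right_cancel)
qed

text \<open>Two representatives of one element are congruent to each other, so uniqueness need only
  be tested inside \<open>Y\<close>.\<close>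

lemma representativesI:
  assumes "\<And>x. x \<in> carrier X \<Longrightarrow> \<exists>y \<in> Y. (x, y) \<in> \<omega>"
    and "\<And>y z. \<lbrakk>y \<in> Y; z \<in> Y; (y, z) \<in> \<omega>\<rbrakk> \<Longrightarrow> y = z"
  shows representatives
  unfolding representatives_def using assms \<omega>_sym \<omega>_trans by metis

lemma representatives_ex:
  "\<lbrakk>representatives; x \<in> carrier X\<rbrakk> \<Longrightarrow> \<exists>y \<in> Y. (x, y) \<in> \<omega>"
  unfolding representatives_def by blast

lemma representatives_unique:
  "\<lbrakk>representatives; y \<in> Y; z \<in> Y; (y, z) \<in> \<omega>\<rbrakk> \<Longrightarrow> y = z"
  unfolding representatives_def using \<omega>_refl Y_carrier by blast

section \<open>Near-truss endomorphisms projecting onto \<open>Y\<close>\<close>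

lemma representatives_imp_projection:
  assumes representatives
  shows "\<exists>f \<in> near_truss_hom X X. near_truss_kernel X f = \<omega> \<and>
    (\<forall>y \<in> Y. f y = y) \<and> f ` carrier X \<subseteq> Y"
proof -
  obtain f where fY: "\<And>x. x \<in> carrier X \<Longrightarrow> f x \<in> Y"
    and f\<omega>: "\<And>x. x \<in> carrier X \<Longrightarrow> (x, f x) \<in> \<omega>"
    using representatives_ex[OF assms] by metis
  \<comment> \<open>Any element of \<open>Y\<close> congruent to \<open>x\<close> is
    \<open>f x\<close>. Hence \<open>f\<close> is a morphism: an operation applied to values of
    \<open>f\<close> stays in \<open>Y\<close> and is congruent to the same operation applied to the
    arguments.\<close>
  have f_eqI: "f x = y" if "(x, y) \<in> \<omega>" "y \<in> Y" for x y
    using that representatives_unique[OF assms] fY f\<omega> \<omega>_carrier \<omega>_sym \<omega>_trans by metis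
  have "f \<in> near_truss_hom X X"
    by (auto simp: near_truss_hom_def fY f\<omega> Y_carrier intro!: f_eqI tern_cong tmult_cong
        Y_tern Y_tmult)
  moreover have "near_truss_kernel X f = \<omega>"
  proof -
    have "f x = f y \<longleftrightarrow> (x, y) \<in> \<omega>" if "x \<in> carrier X" "y \<in> carrier X" for x y
      using that f_eqI fY f\<omega> \<omega>_sym \<omega>_trans by metis
    then show ?thesis
      unfolding near_truss_kernel_def using \<omega>_carrier by auto
  qed
  ultimately show ?thesis
    using f_eqI fY \<omega>_refl Y_carrier by blast
qed

lemma idempotent_onto_imp_fixes:
  assumes "idempotent_on (carrier X) f" "f ` carrier X = Y" "y \<in> Y"
  shows "f y = y"
  using assms unfolding idempotent_on_def by auto

text \<open>A map into \<open>Y\<close> that fixes \<open>Y\<close> pointwise is idempotent and has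
  image exactly \<open>Y\<close>.\<close>

lemma projection_imp_idempotent:
  assumes "\<exists>f \<in> near_truss_hom X X. near_truss_kernel X f = \<omega> \<and>
    (\<forall>y \<in> Y. f y = y) \<and> f ` carrier X \<subseteq> Y"
  shows "\<exists>f \<in> near_truss_hom X X. idempotent_on (carrier X) f \<and>
    f ` carrier X = Y \<and> near_truss_kernel X f = \<omega>"
proof -
  obtain f where f: "f \<in> near_truss_hom X X" "near_truss_kernel X f = \<omega>"
    "\<forall>y \<in> Y. f y = y" "f ` carrier X \<subseteq> Y"
    using assms by blast
  have "y \<in> f ` carrier X" if "y \<in> Y" for y
    using that f(3) Y_carrier[of y] by (intro image_eqI[of _ _ y]) auto
  moreover have "idempotent_on (carrier X) f"
    using f by (auto simp: idempotent_on_def)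
  ultimately show ?thesis
    using f by blast
qed

section \<open>Idempotent J-ring endomorphisms\<close>

lemma sub_j_ring_truss_j_ring:
  assumes "e \<in> Y"
  shows "sub_j_ring Y (truss_j_ring X e)"
proof -
  have "subgroup Y (truss_j_ring X e)"
    using assms Y_carrier Y_tern by (intro subgroup.intro) (auto simp: inv_truss_j_ring)
  then show ?thesis
    by (simp add: sub_j_ring_def Y_tmult)
qed

lemma normal_class:
  assumes "e \<in> carrier X"
  shows "\<omega> `` {e} \<lhd> truss_j_ring X e"
proof -
  interpret G: group "truss_j_ring X e"
    by (rule group_truss_j_ring[OF assms])
  have class_tern: "tern X x y z \<in> \<omega> `` {e}"
    if "x \<in> \<omega> `` {e}" "y \<in> \<omega> `` {e}" "z \<in> \<omega> `` {e}" for x y z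
    using tern_cong[of e x e y e z] that assms by (simp add: tern_left_cancel)
  have e: "e \<in> \<omega> `` {e}"
    using assms \<omega>_refl by simp
  have "subgroup (\<omega> `` {e}) (truss_j_ring X e)"
    using assms class_tern[OF _ e] class_tern[OF e _ e] e \<omega>_carrier
    by (intro subgroup.intro) (auto simp: inv_truss_j_ring)
  moreover have "tern X (tern X x e n) e (tern X e x e) \<in> \<omega> `` {e}"
    if "x \<in> carrier X" "n \<in> \<omega> `` {e}" for x n
  proof -
    \<comment> \<open>The right-hand element is the conjugate x + n - x. Replacing \<open>n\<close>
      by the congruent \<open>e\<close> turns it into x - x, which is \<open>e\<close>.\<close>
    have "(tern X (tern X x e e) e (tern X e x e), tern X (tern X x e n) e (tern X e x e)) \<in> \<omega>"
      using that assms by (intro tern_cong \<omega>_refl tern_closed) auto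
    then show ?thesis
      using that assms by (simp add: tern_left_cancel tern_right_cancel tern_chain_right)
  qed
  ultimately show ?thesis
    using assms by (auto simp: G.normal_inv_iff inv_truss_j_ring)
qed

text \<open>Both ideal conditions ask for a difference of congruent elements: xn and xe in the
  first, (x + n)y and xy in the second. By \<open>diff\<close> such differences lie in the class of
  \<open>e\<close>.\<close>

lemma j_ideal_class:
  assumes "e \<in> carrier X"
  shows "j_ideal (\<omega> `` {e}) (truss_j_ring X e)"
proof -
  have diff: "tern X x e (tern X e y e) \<in> \<omega> `` {e}" if "(x, y) \<in> \<omega>" for x y
    using \<omega>_iff_tern[of x y e] \<omega>_carrier[OF that] assms that
    by (simp add: tern_chain_right)
  have "(x \<cdot> n, x \<cdot> e) \<in> \<omega>" if "x \<in> carrier X" "(e, n) \<in> \<omega>" for x n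
    using tmult_cong[OF \<omega>_refl \<omega>_sym] that .
  moreover have "(tern X x e n \<cdot> y, x \<cdot> y) \<in> \<omega>"
    if "x \<in> carrier X" "y \<in> carrier X" "(e, n) \<in> \<omega>" for x y n
  proof -
    have "(tern X x e n, tern X x e e) \<in> \<omega>"
      using that assms by (intro tern_cong \<omega>_refl) (auto intro: \<omega>_sym)
    then have "(tern X x e n, x) \<in> \<omega>"
      using that assms by (simp add: tern_right_cancel)
    then show ?thesis
      using tmult_cong \<omega>_refl that by blast
  qed
  ultimately show ?thesis
    using assms diff
    by (auto simp: j_ideal_def normal_class inv_truss_j_ring tmult_closed)
qed

text \<open>The same \<open>f\<close> serves for every \<open>e\<close> in \<open>Y\<close>: it
  fixes \<open>e\<close>, so f x = e means f x = f e, that is, \<open>x\<close> is congruent to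
  \<open>e\<close>.\<close>

lemma idempotent_imp_j_ring_idempotent:
  assumes "\<exists>f \<in> near_truss_hom X X. idempotent_on (carrier X) f \<and>
      f ` carrier X = Y \<and> near_truss_kernel X f = \<omega>"
    and e: "e \<in> Y"
  shows "\<exists>f \<in> j_ring_hom (truss_j_ring X e) (truss_j_ring X e).
    idempotent_on (carrier X) f \<and> f ` carrier X = Y \<and>
    kernel (truss_j_ring X e) (truss_j_ring X e) f = \<omega> `` {e}"
proof -
  obtain f where f: "f \<in> near_truss_hom X X" "idempotent_on (carrier X) f"
    "f ` carrier X = Y" "near_truss_kernel X f = \<omega>"
    using assms by blast
  have "f e = e"
    using idempotent_onto_imp_fixes f(2,3) e .
  then have "kernel (truss_j_ring X e) (truss_j_ring X e) f = \<omega> `` {e}"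
    using f(4) Y_carrier[OF e] by (auto simp: kernel_def near_truss_kernel_def)
  then show ?thesis
    using f near_truss_hom_imp_j_ring_hom \<open>f e = e\<close> Y_carrier[OF e] by blast
qed

text \<open>The kernel on the group side is a single class, yet through differences it determines
  all of \<omega>: \<open>x\<close> and \<open>y\<close> are congruent iff f x = f y. The
  representative of \<open>x\<close> is then \<open>f x\<close>.\<close>

lemma j_ring_idempotent_imp_representatives:
  assumes e: "e \<in> Y"
    and "\<exists>f \<in> j_ring_hom (truss_j_ring X e) (truss_j_ring X e).
      idempotent_on (carrier X) f \<and> f ` carrier X = Y \<and>
      kernel (truss_j_ring X e) (truss_j_ring X e) f = \<omega> `` {e}"
  shows representatives
proof -
  obtain f where f: "f \<in> j_ring_hom (truss_j_ring X e) (truss_j_ring X e)"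
    "idempotent_on (carrier X) f" "f ` carrier X = Y"
    "kernel (truss_j_ring X e) (truss_j_ring X e) f = \<omega> `` {e}"
    using assms by blast
  have eX: "e \<in> carrier X"
    using Y_carrier[OF e] .
  have fX: "f x \<in> carrier X" if "x \<in> carrier X" for x
    using f(3) that Y_carrier by blast
  have \<omega>_iff: "(x, y) \<in> \<omega> \<longleftrightarrow> f x = f y" if xy: "x \<in> carrier X" "y \<in> carrier X" for x y
  proof -
    \<comment> \<open>Only the J-ring operations are known to be preserved, so the bracket is
      rewritten as x + (-y) before \<open>f\<close> is applied.\<close>
    have "f (tern X x y e) = f (tern X x e (tern X e y e))"
      using xy eX by (simp add: tern_chain_right)
    also have "\<dots> = tern X (f x) e (tern X e (f y) e)"
      using f(1) xy eX fX by (auto simp: j_ring_hom_def hom_def inv_truss_j_ring tern_closed)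
    also have "\<dots> = tern X (f x) (f y) e"
      using xy eX fX by (simp add: tern_chain_right)
    finally have "f (tern X x y e) = tern X (f x) (f y) e" .
    moreover have "(x, y) \<in> \<omega> \<longleftrightarrow> f (tern X x y e) = e"
      using \<omega>_iff_tern[OF xy eX] f(4) xy eX tern_closed
      by (auto simp: kernel_def set_eq_iff)
    moreover have "tern X (f x) (f y) e = e \<longleftrightarrow> f x = f y"
      using xy eX fX tern_left_cancel tern_right_cancel tern_chain_left by metis
    ultimately show ?thesis
      by simp
  qed
  show ?thesis
  proof (rule representativesI)
    fix x assume "x \<in> carrier X"
    then show "\<exists>y \<in> Y. (x, y) \<in> \<omega>"
      \<comment> \<open>Idempotence says that \<open>x\<close> and \<open>f x\<close> have the same
        image, so they are congruent.\<close>
      using f(2,3) \<omega>_iff fX by (intro bexI[of _ "f x"]) (auto simp: idempotent_on_def)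
  next
    fix y z assume "y \<in> Y" "z \<in> Y" "(y, z) \<in> \<omega>"
    then show "y = z"
      using idempotent_onto_imp_fixes[OF f(2,3)] \<omega>_iff Y_carrier by metis
  qed
qed

section \<open>Semidirect product decompositions\<close>

lemma normal_class_heap_group:
  assumes "e \<in> carrier X"
  shows "\<omega> `` {e} \<lhd> heap_group X e"
  using normal_class[OF assms] group_heap_group[OF assms] group_truss_j_ring[OF assms]
  by (auto simp: group.normal_inv_iff inv_truss_j_ring_eq_inv_heap_group subgroup_def)

lemma subgroup_heap_group:
  assumes "e \<in> Y"
  shows "subgroup Y (heap_group X e)"
  using assms Y_carrier Y_tern by (intro subgroup.intro) (auto simp: inv_heap_group)

text \<open>If \<open>y\<close> represents \<open>x\<close>, then x = (x - y) + y with x - y in the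
  class of \<open>e\<close>. The intersection is trivial because \<open>e\<close> is the only
  representative of its class.\<close>

lemma representatives_imp_inner_semidirect:
  assumes r: representatives and e: "e \<in> Y"
  shows "inner_semidirect (heap_group X e) Y (\<omega> `` {e})"
proof -
  have eX: "e \<in> carrier X"
    using Y_carrier[OF e] .
  have "x \<in> \<omega> `` {e} <#>\<^bsub>heap_group X e\<^esub> Y" if x: "x \<in> carrier X" for x
  proof -
    obtain y where y: "y \<in> Y" "(x, y) \<in> \<omega>"
      using representatives_ex[OF r x] by blast
    have "tern X x y e \<in> \<omega> `` {e}" "tern X (tern X x y e) e y = x"
      using \<omega>_iff_tern[of x y e] x y eX Y_carrier
      by (auto simp: tern_chain_left tern_right_cancel)
    then show ?thesis
      using y unfolding set_mult_def by force
  qed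
  moreover have "\<omega> `` {e} <#>\<^bsub>heap_group X e\<^esub> Y \<subseteq> carrier X"
    using eX Y_carrier \<omega>_carrier tern_closed by (auto simp: set_mult_def)
  moreover have "\<omega> `` {e} \<inter> Y = {e}"
    using representatives_unique[OF r] e \<omega>_refl[OF eX] by blast
  ultimately show ?thesis
    using e eX
    by (auto simp: inner_semidirect_def group_heap_group normal_class_heap_group
        subgroup_heap_group)
qed

text \<open>Modulo \<omega> a sum n + y with \<open>n\<close> in the class of \<open>e\<close>
  reduces to \<open>y\<close>, which gives existence. For congruent \<open>y\<close> and
  \<open>z\<close> in \<open>Y\<close>, y - z lies in the trivial intersection, which gives
  uniqueness.\<close>

lemma inner_semidirect_imp_representatives:
  assumes e: "e \<in> Y" and s: "inner_semidirect (heap_group X e) Y (\<omega> `` {e})"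
  shows representatives
proof (rule representativesI)
  have eX: "e \<in> carrier X"
    using Y_carrier[OF e] .
  fix x assume "x \<in> carrier X"
  then obtain n y where n: "(e, n) \<in> \<omega>" and y: "y \<in> Y" and x: "x = tern X n e y"
    using s by (auto simp: inner_semidirect_def set_mult_def)
  have "(tern X n e y, tern X e e y) \<in> \<omega>"
    using n y eX Y_carrier by (intro tern_cong \<omega>_refl) (auto intro: \<omega>_sym)
  then show "\<exists>y \<in> Y. (x, y) \<in> \<omega>"
    using x y eX Y_carrier tern_left_cancel by auto
next
  fix y z assume yz: "y \<in> Y" "z \<in> Y" "(y, z) \<in> \<omega>"
  then have "tern X y z e \<in> \<omega> `` {e} \<inter> Y"
    using e Y_tern \<omega>_iff_tern[of y z e] by (simp add: Y_carrier)
  then have "tern X y z e = e"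
    using s by (auto simp: inner_semidirect_def)
  then show "y = z"
    using yz e Y_carrier tern_left_cancel tern_right_cancel tern_chain_left by metis
qed

section \<open>Unique decompositions by the heap operation\<close>

text \<open>Solving a = b - c + d for \<open>b\<close> gives b = a - d + c. Then b - c = a - d, so
  the congruence condition passes from the pair \<open>b\<close>, \<open>c\<close> to
  \<open>a\<close>, \<open>d\<close>.\<close>

lemma tern_decomposition_left:
  assumes "a \<in> carrier X" "b \<in> carrier X" "c \<in> carrier X" "d \<in> carrier X"
  shows "a = tern X b c d \<and> (b, c) \<in> \<omega> \<longleftrightarrow> b = tern X a d c \<and> (a, d) \<in> \<omega>"
proof -
  have "(tern X b c d, d) \<in> \<omega>" if "(b, c) \<in> \<omega>"
    using tern_cong[OF that \<omega>_refl[of c] \<omega>_refl[of d]] assms by (simp add: tern_left_cancel)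
  moreover have "(tern X a d c, c) \<in> \<omega>" if "(a, d) \<in> \<omega>"
    using tern_cong[OF that \<omega>_refl[of d] \<omega>_refl[of c]] assms by (simp add: tern_left_cancel)
  moreover have "tern X (tern X b c d) d c = b" "tern X (tern X a d c) c d = a"
    using assms by (simp_all add: tern_chain_left tern_right_cancel)
  ultimately show ?thesis
    by metis
qed

text \<open>Mirror image of the previous case: -c + b = -d + a.\<close>

lemma tern_decomposition_right:
  assumes "a \<in> carrier X" "b \<in> carrier X" "c \<in> carrier X" "d \<in> carrier X"
  shows "a = tern X d c b \<and> (b, c) \<in> \<omega> \<longleftrightarrow> b = tern X c d a \<and> (a, d) \<in> \<omega>"
proof -
  have "(tern X d c b, d) \<in> \<omega>" if "(b, c) \<in> \<omega>"
    using tern_cong[OF \<omega>_refl[of d] \<omega>_refl[of c] that] assms by (simp add: tern_right_cancel)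
  moreover have "(tern X c d a, c) \<in> \<omega>" if "(a, d) \<in> \<omega>"
    using tern_cong[OF \<omega>_refl[of c] \<omega>_refl[of d] that] assms by (simp add: tern_right_cancel)
  moreover have "tern X c d (tern X d c b) = b" "tern X d c (tern X c d a) = a"
    using assms by (simp_all add: tern_chain_right tern_left_cancel)
  ultimately show ?thesis
    by metis
qed

text \<open>Here \<open>P\<close> abstracts either kind of decomposition and \<open>q\<close> its
  solution for \<open>b\<close>. As \<open>d\<close> determines \<open>b\<close>, the pairs (b, d)
  correspond to the representatives \<open>d\<close> of \<open>a\<close>, whatever \<open>c\<close>
  is.\<close>

lemma representatives_iff_ex1_decomposition:
  assumes decomp: "\<And>a b c d. \<lbrakk>a \<in> carrier X; b \<in> carrier X; c \<in> Y; d \<in> Y\<rbrakk>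
      \<Longrightarrow> P a b c d \<longleftrightarrow> b = q a c d \<and> (a, d) \<in> \<omega>"
    and q: "\<And>a c d. \<lbrakk>a \<in> carrier X; c \<in> carrier X; d \<in> carrier X\<rbrakk> \<Longrightarrow> q a c d \<in> carrier X"
  shows "representatives \<longleftrightarrow>
    (\<forall>a \<in> carrier X. \<forall>c \<in> Y. \<exists>!(b, d). b \<in> carrier X \<and> d \<in> Y \<and> P a b c d)"
proof -
  have ex1_iff: "(\<exists>!(b, d). b \<in> carrier X \<and> d \<in> Y \<and> P a b c d) \<longleftrightarrow> (\<exists>!d. d \<in> Y \<and> (a, d) \<in> \<omega>)"
    if "a \<in> carrier X" "c \<in> Y" for a c
  proof -
    have "(case p of (b, d) \<Rightarrow> b \<in> carrier X \<and> d \<in> Y \<and> P a b c d) \<longleftrightarrow>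
        snd p \<in> Y \<and> (a, snd p) \<in> \<omega> \<and> fst p = q a c (snd p)" for p
      using that decomp q Y_carrier by (cases p) auto
    then show ?thesis
      by (simp add: Ex1_def) (metis fst_conv snd_conv prod.collapse)
  qed
  have "(\<forall>a \<in> carrier X. \<forall>c \<in> Y. \<exists>!(b, d). b \<in> carrier X \<and> d \<in> Y \<and> P a b c d) \<longleftrightarrow>
      (\<forall>a \<in> carrier X. \<forall>c \<in> Y. \<exists>!d. d \<in> Y \<and> (a, d) \<in> \<omega>)"
    by (intro ball_cong refl ex1_iff)
  then show ?thesis
    \<comment> \<open>Some \<open>c\<close> in \<open>Y\<close> must exist for the vacuous
      quantifier over \<open>c\<close> to be dropped.\<close>
    unfolding representatives_def using nonempty by (simp only:) blast
qed

section \<open>The quotient near-truss\<close>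

text \<open>By compatibility of \<omega> each of the three unions runs over a constant nonempty
  family, so it collapses to its value at the chosen representative.\<close>

lemma quotient_tern:
  assumes "x \<in> carrier X" "y \<in> carrier X" "z \<in> carrier X"
  shows "tern (near_truss_quotient X \<omega>) (\<omega> `` {x}) (\<omega> `` {y}) (\<omega> `` {z}) = \<omega> `` {tern X x y z}"
proof -
  have eq: "\<omega> `` {tern X a b c} = \<omega> `` {tern X x y z}"
    if "(x, a) \<in> \<omega>" "(y, b) \<in> \<omega>" "(z, c) \<in> \<omega>" for a b c
    using equiv_class_eq[OF equiv \<omega>_sym[OF tern_cong[OF that]]] .
  show ?thesis
    unfolding near_truss_quotient_def
    by (simp, intro UN_constant_eq[of x "\<omega> `` {x}"] UN_constant_eq[of y "\<omega> `` {y}"]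
        UN_constant_eq[of z "\<omega> `` {z}"] ballI; unfold Image_singleton_iff)
      (assumption | rule eq \<omega>_refl assms)+
qed

lemma quotient_tmult:
  assumes "x \<in> carrier X" "y \<in> carrier X"
  shows "\<omega> `` {x} \<cdot>\<^bsub>near_truss_quotient X \<omega>\<^esub> \<omega> `` {y} = \<omega> `` {x \<cdot> y}"
proof -
  have eq: "\<omega> `` {a \<cdot> b} = \<omega> `` {x \<cdot> y}" if "(x, a) \<in> \<omega>" "(y, b) \<in> \<omega>" for a b
    using equiv_class_eq[OF equiv \<omega>_sym[OF tmult_cong[OF that]]] .
  show ?thesis
    unfolding near_truss_quotient_def
    by (simp, intro UN_constant_eq[of x "\<omega> `` {x}"] UN_constant_eq[of y "\<omega> `` {y}"] ballI;
        unfold Image_singleton_iff)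
      (assumption | rule eq \<omega>_refl assms)+
qed

lemma class_map_hom:
  "(\<lambda>y. \<omega> `` {y}) \<in> near_truss_hom (X\<lparr>carrier := Y\<rparr>) (near_truss_quotient X \<omega>)"
proof -
  have "carrier (near_truss_quotient X \<omega>) = carrier X // \<omega>"
    by (simp add: near_truss_quotient_def)
  then show ?thesis
    by (auto simp: near_truss_hom_def quotient_tern quotient_tmult Y_carrier quotientI)
qed

text \<open>The class map is always a morphism, so only bijectivity matters: injectivity is
  uniqueness of representatives, surjectivity their existence.\<close>

lemma representatives_iff_class_map_iso:
  "representatives \<longleftrightarrow>
    (\<lambda>y. \<omega> `` {y}) \<in> near_truss_iso (X\<lparr>carrier := Y\<rparr>) (near_truss_quotient X \<omega>)"
proof -
  have class_eq: "\<omega> `` {x} = \<omega> `` {y} \<longleftrightarrow> (x, y) \<in> \<omega>" if "x \<in> carrier X" "y \<in> carrier X" for x y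
    using eq_equiv_class_iff[OF equiv that] .
  have "inj_on (\<lambda>y. \<omega> `` {y}) Y \<longleftrightarrow> (\<forall>y \<in> Y. \<forall>z \<in> Y. (y, z) \<in> \<omega> \<longrightarrow> y = z)"
    using class_eq Y_carrier by (auto simp: inj_on_def)
  moreover have "(\<lambda>y. \<omega> `` {y}) ` Y = carrier X // \<omega> \<longleftrightarrow>
      (\<forall>x \<in> carrier X. \<exists>y \<in> Y. (x, y) \<in> \<omega>)"
  proof -
    have quotient: "carrier X // \<omega> = (\<lambda>x. \<omega> `` {x}) ` carrier X"
      by (auto simp: quotient_def)
    have "(\<lambda>y. \<omega> `` {y}) ` Y \<subseteq> (\<lambda>x. \<omega> `` {x}) ` carrier X"
      using Y_carrier by (intro image_mono) blast
    then have "(\<lambda>y. \<omega> `` {y}) ` Y = carrier X // \<omega> \<longleftrightarrow>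
        (\<lambda>x. \<omega> `` {x}) ` carrier X \<subseteq> (\<lambda>y. \<omega> `` {y}) ` Y"
      unfolding quotient by (metis subset_antisym subset_refl)
    then show ?thesis
      using class_eq Y_carrier by (simp add: image_subset_iff image_iff)
  qed
  moreover have "representatives \<longleftrightarrow> (\<forall>y \<in> Y. \<forall>z \<in> Y. (y, z) \<in> \<omega> \<longrightarrow> y = z) \<and>
      (\<forall>x \<in> carrier X. \<exists>y \<in> Y. (x, y) \<in> \<omega>)"
    using representativesI representatives_ex representatives_unique by blast
  ultimately show ?thesis
    using class_map_hom by (auto simp: near_truss_iso_def bij_betw_def near_truss_quotient_def)
qed

end

(* Y is required to be nonempty: for empty Y the conditions quantified over all e or c in Y hold
   vacuously while the remaining ones fail.
   In the last condition the endomorphism is required to take its values in Y: otherwise the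
   identity map satisfies it whenever \<omega> is equality, for every Y. *)
theorem proposition10p1:
  fixes X :: "('a, 'm) near_truss_scheme" and Y :: "'a set" and \<omega> :: "'a rel"
  assumes "left_near_truss X" and "carrier X \<noteq> {}"
    and "subnear_truss Y X" and "Y \<noteq> {}"
    and "near_truss_congruence \<omega> X"
  shows "all_equivalent
    [\<comment> \<open>(a)\<close>
     \<forall>x \<in> carrier X. is_singleton (Y \<inter> \<omega> `` {x}),
     \<comment> \<open>(b)\<close>
     \<exists>f \<in> near_truss_hom X X. idempotent_on (carrier X) f \<and>
        f ` carrier X = Y \<and> near_truss_kernel X f = \<omega>,
     \<comment> \<open>(c)\<close>
     \<forall>e \<in> Y. j_ring (truss_j_ring X e) \<and>
        sub_j_ring Y (truss_j_ring X e) \<and> j_ideal (\<omega> `` {e}) (truss_j_ring X e) \<and>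
        (\<exists>f \<in> j_ring_hom (truss_j_ring X e) (truss_j_ring X e).
           idempotent_on (carrier X) f \<and> f ` carrier X = Y \<and>
           kernel (truss_j_ring X e) (truss_j_ring X e) f = \<omega> `` {e}),
     \<comment> \<open>(d)\<close>
     \<exists>e \<in> Y. j_ring (truss_j_ring X e) \<and>
        sub_j_ring Y (truss_j_ring X e) \<and> j_ideal (\<omega> `` {e}) (truss_j_ring X e) \<and>
        (\<exists>f \<in> j_ring_hom (truss_j_ring X e) (truss_j_ring X e).
           idempotent_on (carrier X) f \<and> f ` carrier X = Y \<and>
           kernel (truss_j_ring X e) (truss_j_ring X e) f = \<omega> `` {e}),
     \<comment> \<open>(e)\<close>
     \<forall>e \<in> Y. inner_semidirect (heap_group X e) Y (\<omega> `` {e}),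
     \<comment> \<open>(f)\<close>
     \<exists>e \<in> Y. inner_semidirect (heap_group X e) Y (\<omega> `` {e}),
     \<comment> \<open>(g)\<close>
     \<forall>a \<in> carrier X. \<forall>c \<in> Y. \<exists>!(b, d). b \<in> carrier X \<and> d \<in> Y \<and>
        a = tern X b c d \<and> (b, c) \<in> \<omega>,
     \<comment> \<open>(h)\<close>
     \<forall>a \<in> carrier X. \<forall>c \<in> Y. \<exists>!(b, d). b \<in> carrier X \<and> d \<in> Y \<and>
        a = tern X d c b \<and> (b, c) \<in> \<omega>,
     \<comment> \<open>(i)\<close>
     (\<lambda>y. \<omega> `` {y}) \<in> near_truss_iso (X\<lparr>carrier := Y\<rparr>) (near_truss_quotient X \<omega>),
     \<comment> \<open>(l)\<close>
     \<exists>f \<in> near_truss_hom X X. near_truss_kernel X f = \<omega> \<and>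
        (\<forall>y \<in> Y. f y = y) \<and> f ` carrier X \<subseteq> Y]"
proof -
  interpret subnear_truss_congruence X Y \<omega>
    using assms by (simp add: subnear_truss_congruence_def subnear_truss_congruence_axioms_def)
  let ?J = "\<lambda>e. j_ring (truss_j_ring X e) \<and>
    sub_j_ring Y (truss_j_ring X e) \<and> j_ideal (\<omega> `` {e}) (truss_j_ring X e) \<and>
    (\<exists>f \<in> j_ring_hom (truss_j_ring X e) (truss_j_ring X e).
       idempotent_on (carrier X) f \<and> f ` carrier X = Y \<and>
       kernel (truss_j_ring X e) (truss_j_ring X e) f = \<omega> `` {e})"
  let ?S = "\<lambda>e. inner_semidirect (heap_group X e) Y (\<omega> `` {e})"
  let ?b = "\<exists>f \<in> near_truss_hom X X. idempotent_on (carrier X) f \<and>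
    f ` carrier X = Y \<and> near_truss_kernel X f = \<omega>"
  let ?l = "\<exists>f \<in> near_truss_hom X X. near_truss_kernel X f = \<omega> \<and>
    (\<forall>y \<in> Y. f y = y) \<and> f ` carrier X \<subseteq> Y"
  obtain e where e: "e \<in> Y"
    using nonempty by blast
  have a: "representatives \<longleftrightarrow> (\<forall>x \<in> carrier X. is_singleton (Y \<inter> \<omega> `` {x}))"
    by (rule representatives_iff_is_singleton)
  have al: "representatives \<longrightarrow> ?l"
    using representatives_imp_projection by (rule impI)
  have lb: "?l \<longrightarrow> ?b"
    using projection_imp_idempotent by (rule impI)
  have bc: "?b \<longrightarrow> (\<forall>e \<in> Y. ?J e)"
    using idempotent_imp_j_ring_idempotent Y_carrier
    by (simp add: j_ring_truss_j_ring sub_j_ring_truss_j_ring j_ideal_class)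
  have da: "(\<exists>e \<in> Y. ?J e) \<longrightarrow> representatives"
    using j_ring_idempotent_imp_representatives by blast
  have ae: "representatives \<longrightarrow> (\<forall>e \<in> Y. ?S e)"
    using representatives_imp_inner_semidirect by blast
  have fa: "(\<exists>e \<in> Y. ?S e) \<longrightarrow> representatives"
    using inner_semidirect_imp_representatives by blast
  have g: "representatives \<longleftrightarrow> (\<forall>a \<in> carrier X. \<forall>c \<in> Y. \<exists>!(b, d). b \<in> carrier X \<and> d \<in> Y \<and>
      a = tern X b c d \<and> (b, c) \<in> \<omega>)"
    using Y_carrier tern_closed tern_decomposition_left
    by (intro representatives_iff_ex1_decomposition[where q = "\<lambda>a c d. tern X a d c"]) auto
  have h: "representatives \<longleftrightarrow> (\<forall>a \<in> carrier X. \<forall>c \<in> Y. \<exists>!(b, d). b \<in> carrier X \<and> d \<in> Y \<and>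
      a = tern X d c b \<and> (b, c) \<in> \<omega>)"
    using Y_carrier tern_closed tern_decomposition_right
    by (intro representatives_iff_ex1_decomposition[where q = "\<lambda>a c d. tern X c d a"]) auto
  note i = representatives_iff_class_map_iso
  \<comment> \<open>The link from the universal to the existential condition is the fixed element
    \<open>e\<close> of \<open>Y\<close>.\<close>
  have cycle: "P \<longleftrightarrow> R" "P' \<longleftrightarrow> R" "(\<forall>e \<in> Y. Q e) \<longleftrightarrow> R" "(\<exists>e \<in> Y. Q e) \<longleftrightarrow> R"
    if "R \<longrightarrow> P" "P \<longrightarrow> P'" "P' \<longrightarrow> (\<forall>e \<in> Y. Q e)" "(\<exists>e \<in> Y. Q e) \<longrightarrow> R" for P P' Q R
    using that e by blast+
  note lbcd = cycle[OF al lb bc da]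
  \<comment> \<open>The semidirect product conditions form a shorter cycle, obtained by taking both
    \<open>P\<close> and \<open>P'\<close> to be \<open>R\<close>.\<close>
  note ef = cycle(3,4)[OF imp_refl imp_refl ae fa]
  show ?thesis
    \<comment> \<open>Every entry of the list becomes \<open>representatives\<close>.\<close>
    unfolding a[symmetric] lbcd ef g[symmetric] h[symmetric] i[symmetric]
    by (simp add: all_equivalent_def)
qed

end
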